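(* Starting from $x^0=(1/n)e$, the Frank-Wolfe method for convex composite optimization involving a logarithmically-homogeneous barrier (FW-LHB), applied to the equivalent problem $\min_{x\in\Delta_n}-\sum_{j=1}^m\ln(a_j^\top x)$, finds an $\varepsilon$-optimal solution of the problem $\max_{x\in\Delta_n} f(x)$, with $f(x)=\frac1m\sum_{j=1}^m\ln(a_j^\top x)$, in at most $$O\big(m^2n\ln(n)(\ln(m)+\ln\ln(n))+m^2n/\varepsilon\big)$$ arithmetic operations.
   Context: Let $m,n$ be positive integers, $\Delta_n=\{x\in\mathbb{R}^n: x\ge 0,\ \sum_{i=1}^n x_i=1\}$, $e=(1,\dots,1)^\top\in\mathbb{R}^n$, and let $a_1,\dots,a_m\in\mathbb{R}^n$ be entrywise nonnegative and nonzero. Let $f(x)=\frac1m\sum_{j=1}^m\ln(a_j^\top x)$ (with $\ln 0=-\infty$) and $f^*=\max_{x\in\Delta_n}f(x)$. An $\varepsilon$-optimal solution is a point $x\in\Delta_n$ with $f^*-f(x)\le\varepsilon$. (Equivalently, $x$ is an $m\varepsilon$-optimal solution of $\min_{x\in\Delta_n}F(x)$, where $F(x)=-\sum_{j=1}^m\ln(a_j^\top x)=-m f(x)$.) FW-LHB for $\min_{x\in\Delta_n}F(x)$ (in its standard form with adaptive step size): from $x^0=(1/n)e$, for $t\ge 0$: compute $\nabla F(x^t)$ and $v^t\in\arg\min_{v\in\Delta_n}\langle\nabla F(x^t),v\rangle$; set $G_t=\langle\nabla F(x^t),x^t-v^t\rangle\ge 0$ and stop if $G_t=0$ (then $x^t$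 is optimal); set $D_t=\Big(\sum_{j=1}^m\big(\tfrac{a_j^\top(v^t-x^t)}{a_j^\top x^t}\big)^2\Big)^{1/2}$, $\alpha_t=\min\Big\{\tfrac{G_t}{D_t(G_t+D_t)},1\Big\}$, and $x^{t+1}=x^t+\alpha_t(v^t-x^t)$.
   Formalization: In the bound, ln(n) and ln ln(n) are read with n replaced by max(n,3), because ln ln(n) is undefined for n=1 and the bound is negative e.g. for m=1, n=2, ε=5; for n≥3 the bound is unchanged. *)

theory Defs
  imports "HOL-Analysis.Analysis" "HOL-Library.Monad_Syntax"
begin

text \<open>
  Vectors of \<open>\<real>\<^sup>n\<close> are lists of length \<open>n\<close>, so that one constant can be uniform in \<open>n\<close>.
  The data \<open>a\<^sub>1, \<dots>, a\<^sub>m\<close> form a list \<open>a\<close> of \<open>m\<close> such vectors.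
\<close>

definition dot :: "real list \<Rightarrow> real list \<Rightarrow> real" where
  "dot u v = sum_list (map2 (*) u v)"

definition vdiff :: "real list \<Rightarrow> real list \<Rightarrow> real list" where
  "vdiff u v = map2 (-) u v"

definition unit_simplex :: "nat \<Rightarrow> real list set" where
  "unit_simplex n = {x. length x = n \<and> (\<forall>z\<in>set x. 0 \<le> z) \<and> sum_list x = 1}"

definition log_instance :: "nat \<Rightarrow> nat \<Rightarrow> real list list \<Rightarrow> bool" where
  "log_instance m n a \<longleftrightarrow> length a = m \<and>
     (\<forall>c\<in>set a. length c = n \<and> (\<forall>z\<in>set c. 0 \<le> z) \<and> (\<exists>z\<in>set c. z \<noteq> 0))"


text \<open>Logarithm with \<open>ln 0 = -\<infinity>\<close>; the library's real \<open>ln\<close> has \<open>ln 0 = 0\<close>.\<close>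

definition eln :: "real \<Rightarrow> ereal" where
  "eln z = (if 0 < z then ereal (ln z) else -\<infinity>)"

definition objective :: "real list list \<Rightarrow> real list \<Rightarrow> ereal" where
  "objective a x = ereal (1 / real (length a)) * (\<Sum>c\<leftarrow>a. eln (dot c x))"

definition opt_value :: "nat \<Rightarrow> real list list \<Rightarrow> ereal" where
  "opt_value n a = (SUP x\<in>unit_simplex n. objective a x)"

definition eps_optimal :: "nat \<Rightarrow> real list list \<Rightarrow> real \<Rightarrow> real list \<Rightarrow> bool" where
  "eps_optimal n a \<epsilon> x \<longleftrightarrow> x \<in> unit_simplex n \<and> opt_value n a - objective a x \<le> ereal \<epsilon>"


text \<open>\<open>barrier a\<close> is \<open>F\<close>. It is real-valued, hence meaningful only where all \<open>dot c x\<close> are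
  positive; this holds along the iterates.\<close>

definition barrier :: "real list list \<Rightarrow> real list \<Rightarrow> real" where
  "barrier a x = - (\<Sum>c\<leftarrow>a. ln (dot c x))"

definition grad :: "(real list \<Rightarrow> real) \<Rightarrow> real list \<Rightarrow> real list" where
  "grad h x = map (\<lambda>i. deriv (\<lambda>s. h (x[i := s])) (x ! i)) [0..<length x]"

definition fw_gap :: "real list list \<Rightarrow> real list \<Rightarrow> real list \<Rightarrow> real" where
  "fw_gap a x v = dot (grad (barrier a) x) (vdiff x v)"

definition fw_dist :: "real list list \<Rightarrow> real list \<Rightarrow> real list \<Rightarrow> real" where
  "fw_dist a x v = sqrt (\<Sum>c\<leftarrow>a. (dot c (vdiff v x) / dot c x)\<^sup>2)"

definition fw_stepsize :: "real list list \<Rightarrow> real list \<Rightarrow> real list \<Rightarrow> real" where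
  "fw_stepsize a x v =
     (let G = fw_gap a x v; D = fw_dist a x v in min (G / (D * (G + D))) 1)"

definition is_lmo_answer :: "nat \<Rightarrow> real list \<Rightarrow> real list \<Rightarrow> bool" where
  "is_lmo_answer n g v \<longleftrightarrow> is_arg_min (dot g) (\<lambda>w. w \<in> unit_simplex n) v"

text \<open>\<open>fw_lhb_iterate n a t x\<close>: some run of FW-LHB, for some choice of the minimizers \<open>v\<close>,
  performs \<open>t\<close> full iterations and arrives at \<open>x\<close>. A zero gap stops the run.\<close>

inductive fw_lhb_iterate :: "nat \<Rightarrow> real list list \<Rightarrow> nat \<Rightarrow> real list \<Rightarrow> bool" for n a where
  start: "fw_lhb_iterate n a 0 (replicate n (1 / real n))"
| step: "fw_lhb_iterate n a t x \<Longrightarrow> is_lmo_answer n (grad (barrier a) x) v \<Longrightarrow>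
    fw_gap a x v \<noteq> 0 \<Longrightarrow>
    fw_lhb_iterate n a (Suc t) (map2 (\<lambda>xi vi. xi + fw_stepsize a x v * (vi - xi)) x v)"


text \<open>
  Exact real arithmetic at unit cost: each addition, subtraction, multiplication, division,
  square root and comparison of reals counts one. Copying and indexing are free.
  The second component of a \<open>counted\<close> value is the number of operations spent; apart from the
  linear minimization routine, which reports its own cost, all programs compute on reals only
  through the charged primitives.
\<close>

type_synonym 'a counted = "'a \<times> nat"

definition cret :: "'a \<Rightarrow> 'a counted" where
  "cret x = (x, 0)"

definition cbind :: "'a counted \<Rightarrow> ('a \<Rightarrow> 'b counted) \<Rightarrow> 'b counted" where
  "cbind p f = (fst (f (fst p)), snd p + snd (f (fst p)))"

adhoc_overloading bind \<rightleftharpoons> cbind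

definition cadd :: "real \<Rightarrow> real \<Rightarrow> real counted" where "cadd x y = (x + y, 1)"
definition csub :: "real \<Rightarrow> real \<Rightarrow> real counted" where "csub x y = (x - y, 1)"
definition cmul :: "real \<Rightarrow> real \<Rightarrow> real counted" where "cmul x y = (x * y, 1)"
definition cdiv :: "real \<Rightarrow> real \<Rightarrow> real counted" where "cdiv x y = (x / y, 1)"
definition csqrt_real :: "real \<Rightarrow> real counted" where "csqrt_real x = (sqrt x, 1)"
definition cless :: "real \<Rightarrow> real \<Rightarrow> bool counted" where "cless x y = (x < y, 1)"
definition ceq :: "real \<Rightarrow> real \<Rightarrow> bool counted" where "ceq x y = (x = y, 1)"

fun cmap :: "('a \<Rightarrow> 'b counted) \<Rightarrow> 'a list \<Rightarrow> 'b list counted" where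
  "cmap f [] = cret []"
| "cmap f (x # xs) = do { y \<leftarrow> f x; ys \<leftarrow> cmap f xs; cret (y # ys) }"

definition cmap2 :: "('a \<Rightarrow> 'b \<Rightarrow> 'c counted) \<Rightarrow> 'a list \<Rightarrow> 'b list \<Rightarrow> 'c list counted" where
  "cmap2 f xs ys = cmap (\<lambda>(x, y). f x y) (zip xs ys)"

fun csum :: "real list \<Rightarrow> real counted" where
  "csum [] = cret 0"
| "csum (x # xs) = do { s \<leftarrow> csum xs; cadd x s }"

definition cdot :: "real list \<Rightarrow> real list \<Rightarrow> real counted" where
  "cdot u v = do { ps \<leftarrow> cmap2 cmul u v; csum ps }"

text \<open>\<open>cgrad n us a\<close> computes \<open>- (\<Sum>\<^sub>j a\<^sub>j / u\<^sub>j)\<close>, which is the gradient at \<open>x\<close> of \<open>barrier a\<close>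
  for \<open>u\<^sub>j = dot a\<^sub>j x\<close>.\<close>

fun cgrad :: "nat \<Rightarrow> (real \<times> real list) list \<Rightarrow> real list counted" where
  "cgrad n [] = cret (replicate n 0)"
| "cgrad n ((u, c) # ucs) = do {
     g \<leftarrow> cgrad n ucs;
     p \<leftarrow> cmap (\<lambda>z. cdiv z u) c;
     cmap2 csub g p }"

text \<open>A linear minimization routine maps the iteration number and the gradient to a point.
  The dependence on the iteration number makes every choice of minimizers \<open>v\<^sup>t\<close> possible.\<close>

type_synonym lmo = "nat \<Rightarrow> real list \<Rightarrow> real list counted"

definition exact_lmo :: "nat \<Rightarrow> nat \<Rightarrow> lmo \<Rightarrow> bool" where
  "exact_lmo \<kappa> n lmo \<longleftrightarrow> (\<forall>t g. length g = n \<longrightarrow>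
     is_lmo_answer n g (fst (lmo t g)) \<and> snd (lmo t g) \<le> \<kappa> * n)"

text \<open>The result \<open>None\<close> means that the method stops at \<open>x\<close>.\<close>

definition fw_iteration :: "lmo \<Rightarrow> real list list \<Rightarrow> nat \<Rightarrow> real list \<Rightarrow> real list option counted"
where
  "fw_iteration lmo a t x = do {
     us \<leftarrow> cmap (\<lambda>c. cdot c x) a;
     g \<leftarrow> cgrad (length x) (zip us a);
     v \<leftarrow> lmo t g;
     xv \<leftarrow> cmap2 csub x v;
     G \<leftarrow> cdot g xv;
     stop \<leftarrow> ceq G 0;
     if stop then cret None
     else do {
       d \<leftarrow> cmap2 csub v x;
       qs \<leftarrow> cmap (\<lambda>c. cdot c d) a;
       rs \<leftarrow> cmap2 cdiv qs us;
       D2 \<leftarrow> cdot rs rs;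
       D \<leftarrow> csqrt_real D2;
       s \<leftarrow> cadd G D;
       den \<leftarrow> cmul D s;
       \<beta> \<leftarrow> cdiv G den;
       small \<leftarrow> cless \<beta> 1;
       let \<alpha> = (if small then \<beta> else 1);
       y \<leftarrow> cmap2 (\<lambda>xi di. do { p \<leftarrow> cmul \<alpha> di; cadd xi p }) x d;
       cret (Some y) } }"

fun fw_loop :: "lmo \<Rightarrow> real list list \<Rightarrow> nat \<Rightarrow> nat \<Rightarrow> real list \<Rightarrow> real list counted" where
  "fw_loop lmo a t 0 x = cret x"
| "fw_loop lmo a t (Suc k) x = do {
     r \<leftarrow> fw_iteration lmo a t x;
     (case r of None \<Rightarrow> cret x | Some y \<Rightarrow> fw_loop lmo a (Suc t) k y) }"

definition fw_lhb :: "lmo \<Rightarrow> real list list \<Rightarrow> nat \<Rightarrow> nat \<Rightarrow> real list counted" where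
  "fw_lhb lmo a n T = do { z \<leftarrow> cdiv 1 (real n); fw_loop lmo a 0 T (replicate n z) }"


text \<open>\<open>cscan i k b ys\<close>: \<open>b\<close> is the least entry so far, at position \<open>i\<close>; \<open>ys\<close> starts at \<open>k\<close>.\<close>

fun cscan :: "nat \<Rightarrow> nat \<Rightarrow> real \<Rightarrow> real list \<Rightarrow> nat counted" where
  "cscan i k b [] = cret i"
| "cscan i k b (y # ys) = do {
     l \<leftarrow> cless y b;
     if l then cscan k (Suc k) y ys else cscan i (Suc k) b ys }"

definition scan_lmo :: lmo where
  "scan_lmo t g = do {
     i \<leftarrow> cscan 0 1 (hd g) (tl g);
     cret ((replicate (length g) 0)[i := 1]) }"

lemma fst_cret [simp]: "fst (cret x) = x" and snd_cret [simp]: "snd (cret x) = 0"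
  by (simp_all add: cret_def)

lemma fst_cbind [simp]: "fst (cbind p f) = fst (f (fst p))"
  and snd_cbind [simp]: "snd (cbind p f) = snd p + snd (f (fst p))"
  by (simp_all add: cbind_def)

lemmas cprim_defs = cadd_def csub_def cmul_def cdiv_def csqrt_real_def cless_def ceq_def

lemma snd_cscan: "snd (cscan i k b ys) = length ys"
  by (induction i k b ys rule: cscan.induct) (auto simp: cprim_defs)

lemma fst_cscan:
  assumes "i < length g" "k \<le> length g" "b = g ! i" "ys = drop k g" "\<forall>j<k. b \<le> g ! j"
  shows "fst (cscan i k b ys) < length g \<and> (\<forall>j<length g. g ! fst (cscan i k b ys) \<le> g ! j)"
  using assms
proof (induction i k b ys rule: cscan.induct)
  case (1 i k b)
  then show ?case by auto
next
  case (2 i k b y ys)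
  have k: "k < length g"
    using 2(6) by (metis drop_all linorder_not_less list.distinct(1))
  have y: "y = g ! k" and ys: "ys = drop (Suc k) g"
    using 2(6) k by (metis Cons_nth_drop_Suc list.inject)+
  show ?case
  proof (cases "y < b")
    case True
    have "\<forall>j<Suc k. y \<le> g ! j"
      using True y 2(7) by (auto simp: less_Suc_eq)
    with 2(1)[of True] True k y ys show ?thesis
      by (simp add: cprim_defs)
  next
    case False
    have "\<forall>j<Suc k. b \<le> g ! j"
      using False y 2(7) by (auto simp: less_Suc_eq)
    with 2(2)[of False] False k ys 2(3) 2(5) show ?thesis
      by (simp add: cprim_defs)
  qed
qed

lemma dot_conv_sum: "length u = n \<Longrightarrow> length v = n \<Longrightarrow> dot u v = (\<Sum>i<n. u ! i * v ! i)"
  by (simp add: dot_def sum_list_sum_nth atLeast0LessThan)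

lemma exact_lmo_scan:
  assumes "0 < n"
  shows "exact_lmo 1 n scan_lmo"
  unfolding exact_lmo_def
proof (intro allI impI)
  fix t and g :: "real list"
  assume len: "length g = n"
  define i where "i = fst (cscan 0 1 (hd g) (tl g))"
  define v where "v = (replicate n (0::real))[i := 1]"
  have "g \<noteq> []" using len assms by auto
  then have i: "i < n" "\<And>j. j < n \<Longrightarrow> g ! i \<le> g ! j"
    using fst_cscan[of 0 g 1 "hd g" "tl g"] len assms
    by (auto simp: i_def hd_conv_nth drop_Suc)
  have v_nth: "v ! j = (if j = i then 1 else 0)" if "j < n" for j
    using that i by (simp add: v_def nth_list_update)
  have v: "v \<in> unit_simplex n"
  proof -
    have "sum_list v = (\<Sum>j<n. v ! j)"
      by (simp add: sum_list_sum_nth v_def atLeast0LessThan)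
    also have "\<dots> = (\<Sum>j<n. if j = i then 1 else 0)"
      by (rule sum.cong) (auto simp: v_nth)
    finally have "sum_list v = 1" using i by simp
    moreover have "\<forall>z\<in>set v. 0 \<le> z"
      using v_nth by (auto simp: in_set_conv_nth v_def)
    ultimately show ?thesis by (simp add: unit_simplex_def v_def)
  qed
  have gv: "dot g v = g ! i"
  proof -
    have "dot g v = (\<Sum>j<n. g ! j * v ! j)"
      by (rule dot_conv_sum) (auto simp: len v_def)
    also have "\<dots> = (\<Sum>j<n. if j = i then g ! j else 0)"
      by (rule sum.cong) (auto simp: v_nth)
    finally show ?thesis using i by simp
  qed
  have "g ! i \<le> dot g w" if w: "w \<in> unit_simplex n" for w
  proof -
    have lw: "length w = n" and sw: "(\<Sum>j<n. w ! j) = 1" and pw: "\<And>j. j < n \<Longrightarrow> 0 \<le> w ! j"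
      using w by (auto simp: unit_simplex_def sum_list_sum_nth atLeast0LessThan)
    have "g ! i = (\<Sum>j<n. g ! i * w ! j)"
      using sw by (simp flip: sum_distrib_left)
    also have "\<dots> \<le> (\<Sum>j<n. g ! j * w ! j)"
      by (intro sum_mono mult_right_mono) (auto simp: i pw)
    also have "\<dots> = dot g w"
      using len lw by (simp add: dot_conv_sum)
    finally show ?thesis .
  qed
  then have "is_lmo_answer n g v"
    using v gv by (auto simp: is_lmo_answer_def is_arg_min_def not_less)
  then show "is_lmo_answer n g (fst (scan_lmo t g)) \<and> snd (scan_lmo t g) \<le> 1 * n"
    using len by (simp add: scan_lmo_def v_def i_def snd_cscan)
qed

end

theory Submission
  imports Defs
begin

text \<open>
  Write \<open>G\<close>, \<open>D\<close>, \<open>\<alpha>\<close> for the gap, the distance and the step size at an iterate, and \<open>\<delta>\<close> for the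
  suboptimality of \<open>F\<close> there. The ratios \<open>r\<^sub>j = a\<^sub>j\<^sup>T(v - x) / a\<^sub>j\<^sup>Tx\<close> satisfy \<open>r\<^sub>j \<ge> -1\<close>, sum up to \<open>G\<close>
  and have Euclidean norm \<open>D\<close>, so \<open>D \<le> G + m\<close>. A second-order lower bound on \<open>ln (1 + \<alpha> r\<^sub>j)\<close> shows
  that a step lowers \<open>F\<close> by at least \<open>\<alpha> G / 2 \<ge> G\<^sup>2 / (2 (G + m) (2 G + m))\<close>, whether or not the step
  size is capped at \<open>1\<close>. As \<open>\<delta> \<le> G\<close> by convexity, the potential \<open>7 (\<delta> - m\<^sup>2 / \<delta>)\<close> drops by at
  least \<open>1\<close> in every step. Initially \<open>\<delta> \<le> m ln n\<close>, and \<open>\<delta> > m \<epsilon>\<close> until the target is reached, so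
  \<open>7 (m ln n + m / \<epsilon>) + 1\<close> iterations suffice, each costing \<open>O(m n)\<close> operations.
\<close>

section \<open>Real inequalities: descent along a step and drop of the potential\<close>

text \<open>The right side minus the left side vanishes at \<open>0\<close>. Its derivative is
  \<open>z\<close> times a factor that is nonnegative for \<open>- s \<le> z\<close>, so
  \<open>0\<close> is its minimum there.\<close>

lemma ln_one_plus_lower_bound:
  fixes z s :: real
  assumes "\<bar>z\<bar> \<le> s" "s < 1"
  shows "z - z\<^sup>2 / (2 * (1 - s)) \<le> ln (1 + z)"
proof -
  define f where "f z = ln (1 + z) - z + z\<^sup>2 / (2 * (1 - s))" for z
  define f' where "f' z = z * (1 / (1 - s) - 1 / (1 + z))" for z
  have deriv: "(f has_real_derivative f' y) (at y)" if "- s \<le> y" for y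
  proof -
    have y: "0 < 1 + y" using that assms by simp
    have "((\<lambda>z. ln (1 + z) - z + z\<^sup>2 * K) has_real_derivative
        1 / (1 + y) - 1 + 2 * y * K) (at y)" for K
      using y by (auto intro!: derivative_eq_intros)
    note this[of "1 / (2 * (1 - s))"]
    moreover have "1 / (1 + y) - 1 = - (y / (1 + y))" using y by (simp add: field_simps)
    moreover have "2 * y * (1 / (2 * (1 - s))) = y * (1 / (1 - s))"
      using assms by (simp add: divide_simps)
    ultimately show ?thesis by (simp add: f_def[abs_def] f'_def right_diff_distrib)
  qed
  have "f 0 \<le> f z"
  proof (cases "0 \<le> z")
    case True
    have "0 \<le> f' y" if "0 \<le> y" for y
      unfolding f'_def using that assms True
      by (intro mult_nonneg_nonneg) (auto intro!: divide_left_mono)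
    moreover have "- s \<le> y" if "0 \<le> y" for y using that assms by simp
    ultimately show ?thesis
      using deriv by (intro DERIV_nonneg_imp_nondecreasing[where f = f, OF True]) blast
  next
    case False
    have "f' y \<le> 0" if "- s \<le> y" "y \<le> 0" for y
      unfolding f'_def using that assms
      by (intro mult_nonpos_nonneg) (auto intro!: divide_left_mono)
    with deriv show ?thesis
      using False assms by (intro DERIV_nonpos_imp_nonincreasing[of z 0 f]) force+
  qed
  then show ?thesis by (simp add: f_def)
qed

lemma sum_list_power2_nonneg: "0 \<le> (\<Sum>c\<leftarrow>cs. (f c :: real)\<^sup>2)"
  by (rule sum_list_nonneg) auto

lemma sum_list_power2_le_power2_sum_list:
  fixes f :: "'a \<Rightarrow> real"
  assumes "\<And>c. c \<in> set cs \<Longrightarrow> 0 \<le> f c"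
  shows "(\<Sum>c\<leftarrow>cs. (f c)\<^sup>2) \<le> (\<Sum>c\<leftarrow>cs. f c)\<^sup>2"
  using assms
proof (induction cs)
  case (Cons c cs)
  have "0 \<le> (\<Sum>c\<leftarrow>cs. f c)" using Cons.prems by (intro sum_list_nonneg) auto
  then have "0 \<le> f c * (\<Sum>c\<leftarrow>cs. f c)" using Cons.prems by simp
  with Cons show ?case by (simp add: power2_sum)
qed simp

lemma sum_sum_list_swap:
  fixes f :: "'a \<Rightarrow> 'b \<Rightarrow> real"
  shows "(\<Sum>i\<in>I. \<Sum>c\<leftarrow>cs. f c i) = (\<Sum>c\<leftarrow>cs. \<Sum>i\<in>I. f c i)"
  by (induction cs) (auto simp: sum.distrib)

text \<open>The bound on \<open>\<alpha>\<close> amounts to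
  \<open>\<alpha> * D\<^sup>2 \<le> G * (1 - \<alpha> * D)\<close>. It forces
  \<open>\<alpha> * D < 1\<close>, so the logarithm bound applies to every
  \<open>\<alpha> * r c\<close> with \<open>s = \<alpha> * D\<close>, and the quadratic terms cost
  at most half of the linear gain \<open>\<alpha> * G\<close>. Since \<open>\<alpha>\<close> is only
  bounded from above, capped steps are covered.\<close>

lemma log_step_decrease:
  fixes r :: "'a \<Rightarrow> real" and D G \<alpha> :: real
  assumes G: "G = (\<Sum>c\<leftarrow>cs. r c)" and D: "D = sqrt (\<Sum>c\<leftarrow>cs. (r c)\<^sup>2)"
    and pos: "0 < G" "0 < D" and \<alpha>: "0 \<le> \<alpha>" "\<alpha> \<le> G / (D * (G + D))"
  shows "\<And>c. c \<in> set cs \<Longrightarrow> \<bar>\<alpha> * r c\<bar> < 1"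
    and "\<alpha> * G / 2 \<le> (\<Sum>c\<leftarrow>cs. ln (1 + \<alpha> * r c))"
proof -
  have \<alpha>': "\<alpha> * (D * (G + D)) \<le> G"
    using \<alpha>(2) pos by (simp add: pos_le_divide_eq)
  then have "\<alpha> * D * (G + D) < 1 * (G + D)" using pos by (simp add: algebra_simps)
  then have s: "\<alpha> * D < 1" using pos by (simp add: mult_less_cancel_right)
  have D2: "D\<^sup>2 = (\<Sum>c\<leftarrow>cs. (r c)\<^sup>2)"
    unfolding D by (rule real_sqrt_pow2) (rule sum_list_power2_nonneg)
  have rD: "\<bar>\<alpha> * r c\<bar> \<le> \<alpha> * D" if "c \<in> set cs" for c
  proof -
    have "(r c)\<^sup>2 \<le> D\<^sup>2" unfolding D2 using that
      by (intro member_le_sum_list) auto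
    then have "\<bar>r c\<bar> \<le> D" using pos by (simp add: abs_le_square_iff[symmetric])
    then show ?thesis using \<alpha> by (simp add: abs_mult mult_left_mono)
  qed
  show "\<bar>\<alpha> * r c\<bar> < 1" if "c \<in> set cs" for c using rD[OF that] s by linarith
  have "\<alpha> * D\<^sup>2 \<le> G * (1 - \<alpha> * D)" using \<alpha>' by (simp add: algebra_simps power2_eq_square)
  then have "\<alpha> * (\<alpha> * D\<^sup>2) \<le> \<alpha> * (G * (1 - \<alpha> * D))" using \<alpha>(1) by (rule mult_left_mono)
  then have "\<alpha>\<^sup>2 * D\<^sup>2 / (2 * (1 - \<alpha> * D)) \<le> \<alpha> * G / 2"
    using s by (simp add: pos_divide_le_eq power2_eq_square algebra_simps)
  then have "\<alpha> * G / 2 \<le> \<alpha> * G - \<alpha>\<^sup>2 * D\<^sup>2 / (2 * (1 - \<alpha> * D))" by linarith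
  also have "\<dots> = (\<Sum>c\<leftarrow>cs. \<alpha> * r c - (\<alpha> * r c)\<^sup>2 / (2 * (1 - \<alpha> * D)))"
    unfolding D2 G
    by (induction cs) (auto simp: algebra_simps power_mult_distrib add_divide_distrib)
  also have "\<dots> \<le> (\<Sum>c\<leftarrow>cs. ln (1 + \<alpha> * r c))"
    by (rule sum_list_mono) (rule ln_one_plus_lower_bound[OF rD s])
  finally show "\<alpha> * G / 2 \<le> (\<Sum>c\<leftarrow>cs. ln (1 + \<alpha> * r c))" .
qed

text \<open>For \<open>d\<close> large against \<open>m\<close> the drop of \<open>d\<close> itself
  is bounded below by a constant; for small \<open>d\<close> the growth of
  \<open>m\<^sup>2 / d\<close> is. Their sum handles both regimes at once.\<close>

lemma potential_decrease:
  fixes m d d' G :: real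
  assumes "0 < m" "0 < d'" "0 < d" "d \<le> G"
    and dec: "d' \<le> d - G\<^sup>2 / (2 * ((G + m) * (2 * G + m)))"
  shows "7 * (d' - m\<^sup>2 / d') \<le> 7 * (d - m\<^sup>2 / d) - 1"
proof -
  have half: "x\<^sup>2 / (2 * (y * z)) = x / y * (x / z) / 2" for x y z :: real
    by (simp add: power2_eq_square)
  \<comment> \<open>The guaranteed decrease with \<open>G\<close> replaced by \<open>d\<close>. It
    is no larger, because \<open>G / (G + m)\<close> and \<open>G / (2 * G + m)\<close> grow with
    \<open>G\<close>.\<close>
  define h where "h = d\<^sup>2 / (2 * ((d + m) * (2 * d + m)))"
  have "d / (d + m) \<le> G / (G + m)" "d / (2 * d + m) \<le> G / (2 * G + m)"
    using assms by (auto simp: field_simps)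
  then have "d / (d + m) * (d / (2 * d + m)) \<le> G / (G + m) * (G / (2 * G + m))"
    using assms by (intro mult_mono) auto
  then have "h \<le> G\<^sup>2 / (2 * ((G + m) * (2 * G + m)))"
    unfolding h_def half by (rule divide_right_mono) simp
  with dec have dec': "h \<le> d - d'" by simp
  have hpos: "0 < h" using assms by (simp add: h_def)
  have "m\<^sup>2 * (h / d\<^sup>2) \<le> m\<^sup>2 * ((d - d') / (d * d'))"
  proof (rule mult_left_mono)
    have "d' \<le> d" using dec' hpos by simp
    then have "d * d' \<le> d\<^sup>2" using assms by (simp add: power2_eq_square)
    then show "h / d\<^sup>2 \<le> (d - d') / (d * d')"
      using dec' hpos assms by (intro frac_le) auto
  qed simp
  also have "\<dots> = m\<^sup>2 / d' - m\<^sup>2 / d" using assms by (simp add: field_simps)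
  finally have 1: "m\<^sup>2 * (h / d\<^sup>2) \<le> m\<^sup>2 / d' - m\<^sup>2 / d" .
  have "1 \<le> 7 * (h + m\<^sup>2 * (h / d\<^sup>2))"
  proof -
    have "h + m\<^sup>2 * (h / d\<^sup>2) = (d\<^sup>2 + m\<^sup>2) / (2 * ((d + m) * (2 * d + m)))"
      using assms by (simp add: h_def add_divide_distrib)
    \<comment> \<open>Source of the constant 7: as
      \<open>6 * d * m \<le> 3 * (d\<^sup>2 + m\<^sup>2)\<close>, the left side is at most
      \<open>7 * d\<^sup>2 + 5 * m\<^sup>2\<close>.\<close>
    moreover have "2 * ((d + m) * (2 * d + m)) \<le> 7 * (d\<^sup>2 + m\<^sup>2)"
    proof -
      have "2 * ((d + m) * (2 * d + m)) = 7 * (d\<^sup>2 + m\<^sup>2) - (3 * (d - m)\<^sup>2 + 2 * m\<^sup>2)"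
        by (simp add: power2_eq_square algebra_simps)
      also have "\<dots> \<le> 7 * (d\<^sup>2 + m\<^sup>2)"
        using zero_le_power2[of "d - m"] zero_le_power2[of m] by linarith
      finally show ?thesis .
    qed
    moreover have "0 < 2 * ((d + m) * (2 * d + m))" using assms by simp
    ultimately show ?thesis by (simp add: pos_le_divide_eq)
  qed
  then have "1 \<le> 7 * (d - d' + (m\<^sup>2 / d' - m\<^sup>2 / d))"
    using 1 dec' by (elim order_trans) (intro mult_left_mono add_mono, auto)
  then show ?thesis by (simp add: algebra_simps)
qed

section \<open>Inner products of lists and the simplex\<close>

lemma length_vdiff [simp]: "length (vdiff u v) = min (length u) (length v)"
  by (simp add: vdiff_def)

lemma dot_vdiff:
  assumes "length c = n" "length u = n" "length v = n"
  shows "dot c (vdiff u v) = dot c u - dot c v"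
  using assms by (simp add: dot_conv_sum vdiff_def sum_subtractf right_diff_distrib)

lemma dot_convex_step:
  assumes "length c = n" "length x = n" "length v = n"
  shows "dot c (map2 (\<lambda>xi vi. xi + \<alpha> * (vi - xi)) x v) = dot c x + \<alpha> * (dot c v - dot c x)"
  using assms
  by (simp add: dot_conv_sum sum.distrib sum_subtractf sum_distrib_left algebra_simps)

lemma dot_replicate: "length c = n \<Longrightarrow> dot c (replicate n z) = sum_list c * z"
  by (simp add: dot_conv_sum sum_list_sum_nth atLeast0LessThan sum_distrib_right)

text \<open>Lets \<open>dot_convex_step\<close>, applied to the all-ones vector, show that a step
  preserves the coordinate sum.\<close>

lemma sum_list_eq_dot: "length x = n \<Longrightarrow> sum_list x = dot (replicate n 1) x"
  by (simp add: dot_conv_sum sum_list_sum_nth atLeast0LessThan)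

lemma dot_nonneg:
  assumes "length c = length w" "\<forall>z\<in>set c. 0 \<le> z" "\<forall>z\<in>set w. 0 \<le> z"
  shows "0 \<le> dot c w"
  using assms by (auto simp: dot_conv_sum intro!: sum_nonneg mult_nonneg_nonneg)

text \<open>Coordinates of a simplex point are at most 1. As the product with the uniform point is
  \<open>sum_list c / real n\<close>, this bounds every product by \<open>n\<close> times its
  starting value.\<close>

lemma dot_le_sum_list:
  assumes "length c = n" "\<forall>z\<in>set c. 0 \<le> z" "w \<in> unit_simplex n"
  shows "dot c w \<le> sum_list c"
proof -
  have w: "length w = n" "\<forall>z\<in>set w. 0 \<le> z" "sum_list w = 1"
    using assms by (auto simp: unit_simplex_def)
  have "w ! i \<le> 1" if "i < n" for i
    using w that member_le_sum_list[of "w ! i" w] by auto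
  then have "(\<Sum>i<n. c ! i * w ! i) \<le> (\<Sum>i<n. c ! i * 1)"
    using assms by (intro sum_mono mult_left_mono) auto
  then show ?thesis using assms w by (simp add: dot_conv_sum sum_list_sum_nth atLeast0LessThan)
qed

lemma sum_list_pos_if_nonzero:
  fixes c :: "real list"
  assumes "\<forall>z\<in>set c. 0 \<le> z" "\<exists>z\<in>set c. z \<noteq> 0"
  shows "0 < sum_list c"
proof -
  have "sum_list c \<noteq> 0" using assms sum_list_nonneg_eq_0_iff[of c] by auto
  moreover have "0 \<le> sum_list c" using assms by (simp add: sum_list_nonneg)
  ultimately show ?thesis by simp
qed

lemma convex_step_mem_simplex:
  assumes "x \<in> unit_simplex n" "v \<in> unit_simplex n" "0 \<le> \<alpha>" "\<alpha> \<le> 1"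
  shows "map2 (\<lambda>xi vi. xi + \<alpha> * (vi - xi)) x v \<in> unit_simplex n" (is "?y \<in> _")
proof -
  have len: "length x = n" "length v = n" "length ?y = n"
    and pos: "\<And>i. i < n \<Longrightarrow> 0 \<le> x ! i" "\<And>i. i < n \<Longrightarrow> 0 \<le> v ! i"
    and sum: "sum_list x = 1" "sum_list v = 1"
    using assms by (auto simp: unit_simplex_def)
  have "0 \<le> ?y ! i" if "i < n" for i
  proof -
    have "?y ! i = (1 - \<alpha>) * x ! i + \<alpha> * v ! i" using len that by (simp add: algebra_simps)
    then show ?thesis using pos that assms by simp
  qed
  moreover have "sum_list ?y = 1"
    using len sum by (simp only: sum_list_eq_dot dot_convex_step length_replicate) simp
  ultimately show ?thesis using len by (auto simp: unit_simplex_def in_set_conv_nth)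
qed

section \<open>Values and costs of the counted programs\<close>

lemma fst_cprim:
  "fst (cadd u w) = u + w" "fst (cmul u w) = u * w" "fst (cdiv u w) = u / w"
  "fst (csqrt_real u) = sqrt u" "fst (cless u w) = (u < w)" "fst (ceq u w) = (u = w)"
  and snd_cprim:
  "snd (cadd u w) = 1" "snd (cmul u w) = 1" "snd (cdiv u w) = 1"
  "snd (csqrt_real u) = 1" "snd (cless u w) = 1" "snd (ceq u w) = 1"
  by (simp_all add: cprim_defs)

lemma cmap_conv: "cmap f xs = (map (\<lambda>x. fst (f x)) xs, \<Sum>x\<leftarrow>xs. snd (f x))"
  by (induction xs) (auto simp: cret_def cbind_def)

lemma cmap2_conv:
  "cmap2 f xs ys = (map2 (\<lambda>x y. fst (f x y)) xs ys, \<Sum>(x, y)\<leftarrow>zip xs ys. snd (f x y))"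
  by (simp add: cmap2_def cmap_conv split_def)

lemma csum_conv: "csum xs = (sum_list xs, length xs)"
  by (induction xs) (auto simp: cret_def cbind_def cprim_defs)

text \<open>There are \<open>n\<close> multiplications and \<open>n\<close> additions, as
  \<open>csum\<close> also charges the addition to the initial 0.\<close>

lemma cdot_conv: "length u = n \<Longrightarrow> length v = n \<Longrightarrow> cdot u v = (dot u v, 2 * n)"
  by (auto simp: cdot_def cbind_def cmap2_conv csum_conv cprim_defs dot_def split_def sum_list_triv)

lemma cgrad_cost:
  assumes "\<forall>p\<in>set ucs. length (snd p) = n"
  shows "length (fst (cgrad n ucs)) = n \<and> snd (cgrad n ucs) = 2 * n * length ucs"
  using assms
  by (induction n ucs rule: cgrad.induct)
    (auto simp: cmap2_conv cmap_conv cprim_defs split_def sum_list_triv)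

lemma cgrad_nth:
  assumes "\<forall>p\<in>set ucs. length (snd p) = n" "i < n"
  shows "fst (cgrad n ucs) ! i = - (\<Sum>(u, c)\<leftarrow>ucs. c ! i / u)"
  using assms
  by (induction n ucs rule: cgrad.induct)
    (auto simp: cmap2_conv cmap_conv cprim_defs split_beta cgrad_cost)

section \<open>The barrier and its gradient at a point of the domain\<close>

text \<open>Positivity of all products is the invariant of the method: under it
  \<open>barrier\<close> agrees with \<open>F\<close> and is differentiable.\<close>

locale fw_point =
  fixes m n :: nat and a :: "real list list" and x :: "real list"
  assumes m_pos: "0 < m" and n_pos: "0 < n" and inst: "log_instance m n a"
    and mem: "x \<in> unit_simplex n" and pos: "\<And>c. c \<in> set a \<Longrightarrow> 0 < dot c x"
begin

lemma length_a: "length a = m" and length_x: "length x = n"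
  and length_c: "c \<in> set a \<Longrightarrow> length c = n"
  and c_nonneg: "c \<in> set a \<Longrightarrow> \<forall>z\<in>set c. 0 \<le> z"
  using inst mem by (auto simp: log_instance_def unit_simplex_def)

lemma length_grad: "length (grad (barrier a) x) = n"
  by (simp add: grad_def length_x)

lemma grad_nth:
  assumes i: "i < n"
  shows "grad (barrier a) x ! i = - (\<Sum>c\<leftarrow>a. c ! i / dot c x)"
proof -
  have upd: "dot c (x[i := s]) = dot c x + c ! i * (s - x ! i)" if "c \<in> set a" for c s
  proof -
    have "dot c (x[i := s]) - dot c x = (\<Sum>j<n. c ! j * (x[i := s] ! j - x ! j))"
      using that by (simp add: dot_conv_sum length_c length_x sum_subtractf right_diff_distrib)
    also have "\<dots> = (\<Sum>j<n. if j = i then c ! j * (s - x ! j) else 0)"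
      by (rule sum.cong) (auto simp: length_x nth_list_update)
    finally show ?thesis using i by simp
  qed
  \<comment> \<open>The claim is made for any list of rows from \<open>a\<close>: the locale fixes
    \<open>a\<close>, while induction needs a variable list.\<close>
  have "((\<lambda>s. \<Sum>c\<leftarrow>cs. ln (dot c (x[i := s]))) has_real_derivative (\<Sum>c\<leftarrow>cs. c ! i / dot c x))
      (at (x ! i))" if "set cs \<subseteq> set a" for cs
    using that
  proof (induction cs)
    case (Cons c cs)
    have "((\<lambda>s. ln (dot c x + c ! i * (s - x ! i))) has_real_derivative c ! i / dot c x)
        (at (x ! i))"
      using Cons.prems pos[of c] by (auto intro!: derivative_eq_intros)
    moreover have "(\<lambda>s. ln (dot c (x[i := s]))) = (\<lambda>s. ln (dot c x + c ! i * (s - x ! i)))"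
      using Cons.prems by (simp add: upd)
    ultimately show ?case using Cons by (auto intro!: DERIV_add)
  qed simp
  then have "((\<lambda>s. barrier a (x[i := s])) has_real_derivative - (\<Sum>c\<leftarrow>a. c ! i / dot c x))
      (at (x ! i))"
    unfolding barrier_def by (intro DERIV_minus) simp
  then show ?thesis using i by (simp add: grad_def length_x DERIV_imp_deriv)
qed

lemma dot_grad:
  assumes "length w = n"
  shows "dot (grad (barrier a) x) w = - (\<Sum>c\<leftarrow>a. dot c w / dot c x)"
proof -
  have "dot (grad (barrier a) x) w = - (\<Sum>i<n. \<Sum>c\<leftarrow>a. c ! i * w ! i / dot c x)"
    using assms
    by (simp add: dot_conv_sum length_grad grad_nth sum_negf flip: sum_list_mult_const)
  also have "\<dots> = - (\<Sum>c\<leftarrow>a. dot c w / dot c x)"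
    unfolding sum_sum_list_swap using assms
    by (auto intro!: arg_cong[where f = sum_list] map_cong
        simp: dot_conv_sum length_c sum_divide_distrib)
  finally show ?thesis .
qed

lemma cgrad_eq_grad:
  "cgrad n (zip (map (\<lambda>c. dot c x) a) a) = (grad (barrier a) x, 2 * n * m)"
proof -
  have len: "\<forall>p\<in>set (zip (map (\<lambda>c. dot c x) a) a). length (snd p) = n"
    using length_c by (auto dest: set_zip_rightD)
  have "(\<Sum>(u, c)\<leftarrow>zip (map (\<lambda>c. dot c x) cs) cs. c ! i / u) = (\<Sum>c\<leftarrow>cs. c ! i / dot c x)"
    for i cs
    by (induction cs) auto
  then have "fst (cgrad n (zip (map (\<lambda>c. dot c x) a) a)) = grad (barrier a) x"
    by (intro nth_equalityI) (use len in \<open>auto simp: cgrad_cost cgrad_nth length_grad grad_nth\<close>)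
  then show ?thesis using cgrad_cost[OF len] by (simp add: prod_eq_iff length_a)
qed

lemma objective_eq: "objective a x = ereal (- barrier a x / real m)"
proof -
  have "(\<Sum>c\<leftarrow>cs. eln (dot c x)) = ereal (\<Sum>c\<leftarrow>cs. ln (dot c x))" if "set cs \<subseteq> set a" for cs
    using that by (induction cs) (auto simp: eln_def pos zero_ereal_def)
  then show ?thesis by (simp add: objective_def barrier_def length_a)
qed

lemma objective_le_opt_value: "objective a x \<le> opt_value n a"
  unfolding opt_value_def using mem by (rule SUP_upper)

text \<open>Simplex points with a vanishing product have objective \<open>-\<infinity>\<close>, so
  the supremum is governed by the points where \<open>F\<close> is finite.\<close>

lemma opt_value_leI:
  assumes "\<And>y. fw_point m n a y \<Longrightarrow> - barrier a y \<le> real m * b"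
  shows "opt_value n a \<le> ereal b"
  unfolding opt_value_def
proof (rule SUP_least)
  fix y assume y: "y \<in> unit_simplex n"
  show "objective a y \<le> ereal b"
  proof (cases "\<forall>c\<in>set a. 0 < dot c y")
    case True
    then interpret y: fw_point m n a y
      using m_pos n_pos inst y by unfold_locales auto
    show ?thesis using assms[OF y.fw_point_axioms] m_pos
      by (simp add: y.objective_eq field_simps)
  next
    case False
    \<comment> \<open>In \<open>ereal\<close> the sum of \<open>-\<infinity>\<close> and
      \<open>\<infinity>\<close> is \<open>\<infinity>\<close>, so this value must be excluded
      before a single \<open>-\<infinity>\<close> can decide the sum.\<close>
    have not_top: "(\<Sum>c\<leftarrow>cs. eln (dot c y)) \<noteq> \<infinity>" for cs
      by (induction cs) (auto simp: eln_def)
    have "(\<Sum>c\<leftarrow>cs. eln (dot c y)) = -\<infinity>" if "\<exists>c\<in>set cs. \<not> 0 < dot c y" for cs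
      using that
    proof (induction cs)
      case (Cons c cs)
      then show ?case using not_top[of cs] by (auto simp: eln_def)
    qed simp
    with False have "(\<Sum>c\<leftarrow>a. eln (dot c y)) = -\<infinity>" by auto
    then show ?thesis using m_pos by (simp add: objective_def length_a)
  qed
qed

end

section \<open>One step towards a minimizer of the linearization\<close>

locale fw_step = fw_point +
  fixes v :: "real list"
  assumes lmo: "is_lmo_answer n (grad (barrier a) x) v"
begin

abbreviation "G \<equiv> fw_gap a x v"
abbreviation "D \<equiv> fw_dist a x v"
abbreviation "\<alpha> \<equiv> fw_stepsize a x v"
abbreviation "r c \<equiv> dot c (vdiff v x) / dot c x"

lemma v_mem: "v \<in> unit_simplex n"
  and v_min: "w \<in> unit_simplex n \<Longrightarrow> dot (grad (barrier a) x) v \<le> dot (grad (barrier a) x) w"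
  using lmo by (auto simp: is_lmo_answer_def is_arg_min_def not_less)

lemma length_v: "length v = n"
  using v_mem by (simp add: unit_simplex_def)

lemma dot_v_nonneg: "c \<in> set a \<Longrightarrow> 0 \<le> dot c v"
  using v_mem length_c c_nonneg by (intro dot_nonneg) (auto simp: unit_simplex_def)

lemma r_eq: "c \<in> set a \<Longrightarrow> r c = dot c v / dot c x - 1"
  using pos[of c] by (simp add: dot_vdiff[OF length_c length_v length_x] field_simps)

lemma gap_eq: "G = (\<Sum>c\<leftarrow>a. r c)"
proof -
  have "G = - (\<Sum>c\<leftarrow>a. dot c (vdiff x v) / dot c x)"
    by (simp add: fw_gap_def dot_grad length_x length_v)
  also have "\<dots> = (\<Sum>c\<leftarrow>a. - (dot c (vdiff x v) / dot c x))"
    by (simp add: uminus_sum_list_map comp_def)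
  also have "\<dots> = (\<Sum>c\<leftarrow>a. r c)"
    by (intro arg_cong[where f = sum_list] map_cong refl)
      (simp add: dot_vdiff[OF length_c] length_v length_x diff_divide_distrib)
  finally show ?thesis .
qed

text \<open>Convexity enters as \<open>ln z \<le> z - 1\<close>, with \<open>z\<close> the ratio of
  the products at \<open>y\<close> and at \<open>x\<close>. The resulting linear bound is largest at
  the minimizer \<open>v\<close>.\<close>

lemma barrier_diff_le_gap:
  assumes "fw_point m n a y"
  shows "barrier a x - barrier a y \<le> G"
proof -
  interpret y: fw_point m n a y by fact
  have "barrier a x - barrier a y = (\<Sum>c\<leftarrow>a. ln (dot c y) - ln (dot c x))"
    by (simp add: barrier_def sum_list_subtractf)
  also have "\<dots> \<le> (\<Sum>c\<leftarrow>a. - (dot c (vdiff x y) / dot c x))"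
  proof (rule sum_list_mono)
    fix c assume c: "c \<in> set a"
    have "ln (dot c y) - ln (dot c x) = ln (dot c y / dot c x)"
      using pos[OF c] y.pos[OF c] by (simp add: ln_div)
    also have "\<dots> \<le> dot c y / dot c x - 1"
      using pos[OF c] y.pos[OF c] by (intro ln_le_minus_one) simp
    also have "\<dots> = - (dot c (vdiff x y) / dot c x)"
      using pos[OF c] by (simp add: dot_vdiff[OF length_c[OF c] length_x y.length_x] field_simps)
    finally show "ln (dot c y) - ln (dot c x) \<le> - (dot c (vdiff x y) / dot c x)" .
  qed
  also have "\<dots> = dot (grad (barrier a) x) (vdiff x y)"
    by (simp add: dot_grad length_x y.length_x uminus_sum_list_map comp_def)
  also have "\<dots> \<le> G"
    using v_min[OF y.mem]
    by (simp add: fw_gap_def dot_vdiff[OF length_grad] length_x y.length_x length_v)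
  finally show ?thesis .
qed

lemma gap_nonneg: "0 \<le> G"
  using barrier_diff_le_gap[OF fw_point_axioms] by simp

lemma dist_power2: "D\<^sup>2 = (\<Sum>c\<leftarrow>a. (r c)\<^sup>2)"
  unfolding fw_dist_def by (rule real_sqrt_pow2) (rule sum_list_power2_nonneg)

lemma dist_nonneg: "0 \<le> D"
  unfolding fw_dist_def by (simp add: sum_list_power2_nonneg)

lemma dist_pos:
  assumes "G \<noteq> 0"
  shows "0 < D"
proof (rule ccontr)
  assume "\<not> 0 < D"
  then have "(\<Sum>c\<leftarrow>a. (r c)\<^sup>2) = 0" using dist_nonneg dist_power2 by simp
  then have "\<forall>c\<in>set a. r c = 0"
    by (subst (asm) sum_list_nonneg_eq_0_iff) auto
  then have "G = (\<Sum>c\<leftarrow>a. 0)" unfolding gap_eq by (intro arg_cong[where f = sum_list] map_cong) auto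
  with assms show False by simp
qed

text \<open>The shifted ratios \<open>s c = r c + 1\<close> are nonnegative with sum
  \<open>G + real m\<close>, so their squares sum up to at most the square of that. Passing from
  \<open>s\<close> back to \<open>r\<close> subtracts \<open>2 * G + real m\<close>.\<close>

lemma dist_le: "D \<le> G + real m"
proof -
  define s where "s c = dot c v / dot c x" for c
  have "(\<Sum>c\<leftarrow>a. r c) = (\<Sum>c\<leftarrow>a. s c - 1)"
    by (intro arg_cong[where f = sum_list] map_cong refl) (simp add: r_eq s_def)
  then have S: "G + real m = (\<Sum>c\<leftarrow>a. s c)"
    by (simp add: gap_eq sum_list_subtractf sum_list_triv length_a)
  have "(\<Sum>c\<leftarrow>a. (r c)\<^sup>2) = (\<Sum>c\<leftarrow>a. (s c)\<^sup>2 - 2 * s c + 1)"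
    by (intro arg_cong[where f = sum_list] map_cong refl)
      (simp add: r_eq s_def power2_diff)
  then have "D\<^sup>2 = (\<Sum>c\<leftarrow>a. (s c)\<^sup>2) - 2 * (G + real m) + real m"
    by (simp add: dist_power2 S sum_list_subtractf sum_list_addf sum_list_const_mult
        sum_list_triv length_a)
  moreover have "(\<Sum>c\<leftarrow>a. (s c)\<^sup>2) \<le> (G + real m)\<^sup>2"
    unfolding S using pos dot_v_nonneg
    by (intro sum_list_power2_le_power2_sum_list) (auto simp: s_def less_imp_le)
  ultimately have "D\<^sup>2 \<le> (G + real m)\<^sup>2" using gap_nonneg by simp
  then show ?thesis by (rule power2_le_imp_le) (use gap_nonneg in simp)
qed

abbreviation "x_next \<equiv> map2 (\<lambda>xi vi. xi + \<alpha> * (vi - xi)) x v"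

lemma stepsize_bounds: "0 \<le> \<alpha>" "\<alpha> \<le> 1" "\<alpha> \<le> G / (D * (G + D))"
  using gap_nonneg dist_nonneg by (auto simp: fw_stepsize_def Let_def)

text \<open>Both arguments of the minimum are bounded: the quotient by \<open>dist_le\<close>, the
  cap 1 by comparing \<open>G\<close> with the denominator.\<close>

lemma stepsize_lower_bound:
  assumes "G \<noteq> 0"
  shows "G / ((G + real m) * (2 * G + real m)) \<le> \<alpha>"
proof -
  have G: "0 < G" using assms gap_nonneg by simp
  have "G / ((G + real m) * (2 * G + real m)) \<le> G / (D * (G + D))"
    using G dist_pos[OF assms] dist_le m_pos by (intro divide_left_mono mult_mono mult_pos_pos) auto
  moreover have "G \<le> (G + real m) * (2 * G + real m)"
  proof -
    \<comment> \<open>Here \<open>1 \<le> real m\<close> provides the factor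
      \<open>1 \<le> 2 * G + real m\<close>.\<close>
    have "G * 1 \<le> (G + real m) * (2 * G + real m)"
      using G m_pos by (intro mult_mono) auto
    then show ?thesis by simp
  qed
  then have "G / ((G + real m) * (2 * G + real m)) \<le> 1"
    using G m_pos by (simp add: divide_le_eq)
  ultimately show ?thesis by (simp add: fw_stepsize_def Let_def)
qed

lemma dot_next: "c \<in> set a \<Longrightarrow> dot c x_next = dot c x * (1 + \<alpha> * r c)"
  using pos[of c]
  by (simp only: dot_convex_step[OF length_c length_x length_v] r_eq) (simp add: algebra_simps)

text \<open>A step multiplies each product by \<open>1 + \<alpha> * r c\<close>. These factors are
  positive, so the next point stays in the domain, and \<open>F\<close> falls by the sum of their
  logarithms.\<close>

lemma
  assumes "G \<noteq> 0"
  shows next_point: "fw_point m n a x_next"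
    and barrier_decrease:
      "barrier a x_next \<le> barrier a x - G\<^sup>2 / (2 * ((G + real m) * (2 * G + real m)))"
proof -
  have G: "0 < G" using assms gap_nonneg by simp
  have D: "D = sqrt (\<Sum>c\<leftarrow>a. (r c)\<^sup>2)" by (simp add: fw_dist_def)
  note dec = log_step_decrease[OF gap_eq D G dist_pos[OF assms] stepsize_bounds(1,3)]
  have factor: "0 < 1 + \<alpha> * r c" if "c \<in> set a" for c
    using dec(1)[OF that] by linarith
  show "fw_point m n a x_next"
    using m_pos n_pos inst convex_step_mem_simplex[OF mem v_mem stepsize_bounds(1,2)]
    by unfold_locales (auto simp: dot_next pos factor simp del: times_divide_eq_right)
  have "(\<Sum>c\<leftarrow>a. ln (dot c x_next)) = (\<Sum>c\<leftarrow>a. ln (dot c x) + ln (1 + \<alpha> * r c))"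
    by (intro arg_cong[where f = sum_list] map_cong refl)
      (simp add: dot_next ln_mult_pos pos factor del: times_divide_eq_right)
  then have step: "barrier a x_next = barrier a x - (\<Sum>c\<leftarrow>a. ln (1 + \<alpha> * r c))"
    by (simp add: barrier_def sum_list_addf)
  have half: "G\<^sup>2 / (2 * K) = G / K * (G / 2)" for K by (simp add: power2_eq_square)
  have "G / ((G + real m) * (2 * G + real m)) * (G / 2) \<le> \<alpha> * (G / 2)"
    using stepsize_lower_bound[OF assms] G by (intro mult_right_mono) auto
  with step show "barrier a x_next \<le> barrier a x - G\<^sup>2 / (2 * ((G + real m) * (2 * G + real m)))"
    using dec(2) half[of "(G + real m) * (2 * G + real m)"] by linarith
qed

end

section \<open>The iteration program and the loop\<close>

context fw_point
begin

lemma fw_iteration_conv: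
  fixes t :: nat
  assumes exact: "exact_lmo \<kappa> n lmo"
  defines "v \<equiv> fst (lmo t (grad (barrier a) x))"
  shows "fst (fw_iteration lmo a t x) = (if fw_gap a x v = 0 then None
      else Some (map2 (\<lambda>xi vi. xi + fw_stepsize a x v * (vi - xi)) x v))"
    and "snd (fw_iteration lmo a t x) \<le> (21 + \<kappa>) * m * n"
proof -
  interpret fw_step m n a x v
    using exact length_grad by unfold_locales (auto simp: exact_lmo_def v_def)
  have dots: "cmap (\<lambda>c. cdot c w) a = (map (\<lambda>c. dot c w) a, 2 * n * m)" if "length w = n" for w
  proof -
    have "map (\<lambda>c. cdot c w) a = map (\<lambda>c. (dot c w, 2 * n)) a"
      using that by (intro map_cong refl cdot_conv) (simp_all add: length_c)
    then have "map fst (map (\<lambda>c. cdot c w) a) = map (\<lambda>c. dot c w) a"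
      "map snd (map (\<lambda>c. cdot c w) a) = map (\<lambda>c. 2 * n) a"
      by (simp_all only: map_map comp_def fst_conv snd_conv)
    then show ?thesis
      by (simp only: cmap_conv map_map comp_def) (simp add: sum_list_triv length_a)
  qed
  have subs: "cmap2 csub u w = (vdiff u w, n)" if "length u = n" "length w = n" for u w
    using that by (simp add: cmap2_conv cprim_defs vdiff_def split_def sum_list_triv)
  have divs: "cmap2 cdiv (map (\<lambda>c. dot c w) a) (map (\<lambda>c. dot c x) a)
      = (map (\<lambda>c. dot c w / dot c x) a, m)" for w
    by (simp add: cmap2_conv cprim_defs split_def sum_list_triv length_a zip_map_map
        zip_same_conv_map comp_def)
  have sq: "cdot (map r a) (map r a) = ((\<Sum>c\<leftarrow>a. (r c)\<^sup>2), 2 * m)"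
    by (simp add: cdot_conv[of _ m] length_a dot_def zip_map_map zip_same_conv_map comp_def
        power2_eq_square)
  have upd: "cmap2 (\<lambda>xi di. do { p \<leftarrow> cmul b di; cadd xi p }) x (vdiff v x)
      = (map2 (\<lambda>xi vi. xi + b * (vi - xi)) x v, 2 * n)" for b
  proof -
    have "map2 (\<lambda>xi di. xi + b * di) x (vdiff v x) = map2 (\<lambda>xi vi. xi + b * (vi - xi)) x v"
      by (rule nth_equalityI) (auto simp: vdiff_def)
    then show ?thesis
      by (simp add: cmap2_conv cprim_defs split_def sum_list_triv length_x length_v)
  qed
  have gap: "cdot (grad (barrier a) x) (vdiff x v) = (G, 2 * n)"
    by (simp add: cdot_conv[of _ n] length_grad length_x length_v fw_gap_def)
  \<comment> \<open>Matches the strict comparison of the program; in case of equality both branches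
    give 1.\<close>
  have \<alpha>: "\<alpha> = (if G / (D * (G + D)) < 1 then G / (D * (G + D)) else 1)"
    by (simp add: fw_stepsize_def Let_def min_def)
  have cost: "snd (lmo t (grad (barrier a) x)) \<le> \<kappa> * n"
    using exact length_grad by (simp add: exact_lmo_def)
  \<comment> \<open>Passes over the data cost \<open>6 * m * n\<close>, vector operations
    \<open>6 * n\<close>, work on the ratios \<open>3 * m\<close> and scalar operations 6. Each of
    \<open>n\<close>, \<open>m\<close> and 1 is at most \<open>m * n\<close>, whence 21.\<close>
  have "n \<le> m * n" "m \<le> m * n" using m_pos n_pos by auto
  moreover have "1 \<le> m * n" using m_pos n_pos by (simp add: Suc_le_eq)
  moreover have "\<kappa> * n \<le> \<kappa> * (m * n)" using m_pos by simp
  moreover have "2 * n * m = 2 * (m * n)" "(21 + \<kappa>) * m * n = 21 * (m * n) + \<kappa> * (m * n)"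
    by (simp_all add: algebra_simps)
  ultimately have total: "2 * n * m + (2 * n * m + (\<kappa> * n + (n + (2 * n + (1 + (n + (2 * n * m
      + (m + (2 * m + (5 + 2 * n)))))))))) \<le> (21 + \<kappa>) * m * n"
    by linarith
  note conv = fw_iteration_def dots length_x length_v cgrad_eq_grad subs gap divs sq
    upd fst_cprim snd_cprim Let_def
  show "fst (fw_iteration lmo a t x) = (if G = 0 then None else Some x_next)"
    by (simp add: conv flip: v_def) (simp add: \<alpha> fw_dist_def)
  have "snd (fw_iteration lmo a t x) \<le> 2 * n * m + (2 * n * m + (\<kappa> * n + (n + (2 * n + (1 + (n
      + (2 * n * m + (m + (2 * m + (5 + 2 * n))))))))))"
    using cost by (simp add: conv flip: v_def)
  with total show "snd (fw_iteration lmo a t x) \<le> (21 + \<kappa>) * m * n" by (rule order_trans[rotated])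
qed

end

text \<open>The loop recurses after its first iteration, so the induction shifts the clock
  \<open>t\<close> and the sequence \<open>y\<close> together. The first assumption says that none
  of the \<open>k\<close> iterations stops.\<close>

lemma fw_loop_conv:
  assumes "\<And>s. s < k \<Longrightarrow> fst (fw_iteration lmo a (t + s) (y s)) = Some (y (Suc s))"
    and "\<And>s. s < k \<Longrightarrow> snd (fw_iteration lmo a (t + s) (y s)) \<le> b"
  shows "fst (fw_loop lmo a t k (y 0)) = y k \<and> snd (fw_loop lmo a t k (y 0)) \<le> k * b"
  using assms
proof (induction k arbitrary: t y)
  case (Suc k)
  have "fst (fw_loop lmo a (Suc t) k (y (Suc 0))) = y (Suc k)
      \<and> snd (fw_loop lmo a (Suc t) k (y (Suc 0))) \<le> k * b"
    using Suc.prems[of "Suc _"] by (intro Suc.IH[of "Suc t" "\<lambda>s. y (Suc s)"]) auto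
  then show ?case using Suc.prems[of 0] by (auto simp: add_mono)
qed simp

section \<open>Whole runs and the number of iterations\<close>

text \<open>The iterates without the stopping test. They are tied to an actual run as long as all
  earlier gaps are nonzero.\<close>

primrec fw_seq :: "lmo \<Rightarrow> real list list \<Rightarrow> nat \<Rightarrow> nat \<Rightarrow> real list" where
  "fw_seq lmo a n 0 = replicate n (1 / real n)"
| "fw_seq lmo a n (Suc t) =
     (let x = fw_seq lmo a n t; v = fst (lmo t (grad (barrier a) x))
      in map2 (\<lambda>xi vi. xi + fw_stepsize a x v * (vi - xi)) x v)"

locale fw_run =
  fixes m n \<kappa> :: nat and a :: "real list list" and lmo :: lmo
  assumes m_pos: "0 < m" and n_pos: "0 < n" and inst: "log_instance m n a"
    and exact: "exact_lmo \<kappa> n lmo"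
begin

abbreviation "xs \<equiv> fw_seq lmo a n"
abbreviation "vs t \<equiv> fst (lmo t (grad (barrier a) (xs t)))"

lemma start_point: "fw_point m n a (xs 0)"
proof
  show "xs 0 \<in> unit_simplex n"
    using n_pos by (auto simp: unit_simplex_def sum_list_replicate)
  show "0 < dot c (xs 0)" if "c \<in> set a" for c
    using that inst n_pos sum_list_pos_if_nonzero[of c]
    by (auto simp: log_instance_def dot_replicate)
qed (use m_pos n_pos inst in auto)

lemma fw_step_vs:
  assumes "fw_point m n a (xs t)"
  shows "fw_step m n a (xs t) (vs t)"
proof -
  interpret fw_point m n a "xs t" by fact
  show ?thesis
    using exact length_grad by unfold_locales (auto simp: exact_lmo_def)
qed

lemma run_point:
  assumes "\<And>s. s < t \<Longrightarrow> fw_gap a (xs s) (vs s) \<noteq> 0"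
  shows "fw_point m n a (xs t) \<and> fw_lhb_iterate n a t (xs t)"
  using assms
proof (induction t)
  case 0
  show ?case using start_point by (auto intro: fw_lhb_iterate.start)
next
  case (Suc t)
  then have IH: "fw_point m n a (xs t)" "fw_lhb_iterate n a t (xs t)"
    and gap: "fw_gap a (xs t) (vs t) \<noteq> 0" by auto
  interpret fw_step m n a "xs t" "vs t" using IH(1) by (rule fw_step_vs)
  show ?case
    using next_point[OF gap] fw_lhb_iterate.step[OF IH(2) lmo gap] by (simp add: Let_def)
qed

lemma fw_lhb_conv:
  assumes "\<And>s. s < t \<Longrightarrow> fw_gap a (xs s) (vs s) \<noteq> 0"
  shows "fst (fw_lhb lmo a n t) = xs t" and "snd (fw_lhb lmo a n t) \<le> 1 + t * ((21 + \<kappa>) * m * n)"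
proof -
  have point: "fw_point m n a (xs s)" if "s < t" for s
    using run_point[of s] assms that by auto
  note it = fw_point.fw_iteration_conv[OF point exact]
  have "fst (fw_loop lmo a 0 t (xs 0)) = xs t
      \<and> snd (fw_loop lmo a 0 t (xs 0)) \<le> t * ((21 + \<kappa>) * m * n)"
  proof (rule fw_loop_conv)
    show "fst (fw_iteration lmo a (0 + s) (xs s)) = Some (xs (Suc s))" if "s < t" for s
      using it(1)[OF that, of s] assms[OF that] by (simp add: Let_def)
    show "snd (fw_iteration lmo a (0 + s) (xs s)) \<le> (21 + \<kappa>) * m * n" if "s < t" for s
      using it(2)[OF that, of s] by simp
  qed
  then show "fst (fw_lhb lmo a n t) = xs t"
    and "snd (fw_lhb lmo a n t) \<le> 1 + t * ((21 + \<kappa>) * m * n)"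
    by (auto simp: fw_lhb_def cdiv_def)
qed

text \<open>No product exceeds \<open>n\<close> times its value at the uniform point, so each of the
  \<open>m\<close> logarithms can gain at most \<open>ln (real n)\<close>.\<close>

lemma barrier_start_le:
  assumes "fw_point m n a y"
  shows "- barrier a y \<le> - barrier a (xs 0) + real m * ln (real n)"
proof -
  interpret x: fw_point m n a "xs 0" by (rule start_point)
  interpret y: fw_point m n a y by fact
  have "- barrier a y \<le> (\<Sum>c\<leftarrow>a. ln (dot c (xs 0)) + ln (real n))"
    unfolding barrier_def minus_minus
  proof (rule sum_list_mono)
    fix c assume c: "c \<in> set a"
    have "dot c y \<le> dot c (xs 0) * real n"
      using dot_le_sum_list[OF x.length_c[OF c] x.c_nonneg[OF c] y.mem] n_pos
      by (simp add: dot_replicate x.length_c[OF c])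
    then have "ln (dot c y) \<le> ln (dot c (xs 0) * real n)"
      using y.pos[OF c] x.pos[OF c] n_pos by (subst ln_le_cancel_iff) (auto simp del: fw_seq.simps)
    then show "ln (dot c y) \<le> ln (dot c (xs 0)) + ln (real n)"
      using x.pos[OF c] n_pos by (simp add: ln_mult_pos del: fw_seq.simps)
  qed
  then show ?thesis by (simp add: barrier_def sum_list_addf sum_list_triv x.length_a)
qed

lemma opt_value_le:
  "opt_value n a \<le> ereal ((- barrier a (xs 0) + real m * ln (real n)) / real m)"
  using m_pos
  by (intro fw_point.opt_value_leI[OF start_point]) (use barrier_start_le in auto)

definition "opt = real_of_ereal (opt_value n a)"

text \<open>The optimum is finite, between the objective at the start and
  \<open>opt_value_le\<close>; so \<open>real_of_ereal\<close> does not fall back on its value 0 at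
  infinities.\<close>

lemma opt_value_eq: "opt_value n a = ereal opt"
proof -
  interpret x: fw_point m n a "xs 0" by (rule start_point)
  have "ereal (- barrier a (xs 0) / real m) \<le> opt_value n a"
    using x.objective_le_opt_value by (simp only: x.objective_eq)
  with opt_value_le show ?thesis
    unfolding opt_def by (cases "opt_value n a") auto
qed

text \<open>The suboptimality of \<open>F\<close>, whose infimum over its domain in the simplex is
  \<open>- real m * opt\<close>.\<close>

definition "gap t = barrier a (xs t) + real m * opt"

lemma gap_start: "gap 0 \<le> real m * ln (real n)"
  using opt_value_le m_pos
  by (simp add: opt_value_eq gap_def pos_le_divide_eq mult.commute del: fw_seq.simps)

lemma eps_optimal_iff:
  assumes "fw_point m n a (xs t)"
  shows "eps_optimal n a \<epsilon> (xs t) \<longleftrightarrow> gap t \<le> real m * \<epsilon>"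
proof -
  interpret fw_point m n a "xs t" by fact
  have "eps_optimal n a \<epsilon> (xs t) \<longleftrightarrow> opt + barrier a (xs t) / real m \<le> \<epsilon>"
    by (simp add: eps_optimal_def mem opt_value_eq objective_eq)
  also have "\<dots> \<longleftrightarrow> gap t \<le> real m * \<epsilon>"
    using m_pos by (simp add: gap_def field_simps)
  finally show ?thesis .
qed

text \<open>The bound of \<open>barrier_diff_le_gap\<close> is uniform in \<open>y\<close> and so
  passes to the supremum; no maximizer has to be exhibited.\<close>

lemma gap_le_fw_gap:
  assumes "fw_point m n a (xs t)"
  shows "gap t \<le> fw_gap a (xs t) (vs t)"
proof -
  interpret fw_step m n a "xs t" "vs t" using assms by (rule fw_step_vs)
  have "opt_value n a \<le> ereal ((G - barrier a (xs t)) / real m)"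
  proof (rule opt_value_leI)
    fix y assume "fw_point m n a y"
    then show "- barrier a y \<le> real m * ((G - barrier a (xs t)) / real m)"
      using barrier_diff_le_gap[of y] m_pos by simp
  qed
  then show ?thesis using m_pos
    by (simp add: opt_value_eq gap_def pos_le_divide_eq mult.commute)
qed

text \<open>While the target is missed, \<open>gap\<close> exceeds
  \<open>real m * \<epsilon>\<close>, so the Frank-Wolfe gap is positive and the method cannot stop.
  The potential then loses 1 per step, which limits \<open>t\<close>.\<close>

lemma not_eps_optimal_bound:
  assumes \<epsilon>: "0 < \<epsilon>" and not_opt: "\<And>s. s \<le> t \<Longrightarrow> \<not> eps_optimal n a \<epsilon> (xs s)"
  shows "(\<forall>s\<le>t. fw_gap a (xs s) (vs s) \<noteq> 0) \<and> real t \<le> 7 * (real m * ln (real n) + real m / \<epsilon>)"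
proof -
  have point: "fw_point m n a (xs s) \<and> fw_gap a (xs s) (vs s) \<noteq> 0 \<and> real m * \<epsilon> < gap s"
    if "s \<le> t" for s
    using that
  \<comment> \<open>Being in the domain at \<open>s\<close> needs nonzero gaps at all earlier
    indices, hence strong induction.\<close>
  proof (induction s rule: less_induct)
    case (less s)
    then have s: "fw_point m n a (xs s)" using run_point[of s] by auto
    then have "real m * \<epsilon> < gap s" using eps_optimal_iff not_opt less.prems by force
    moreover have "0 < real m * \<epsilon>" using m_pos \<epsilon> by simp
    ultimately show ?case using s gap_le_fw_gap[OF s] by auto
  qed
  have gap_pos: "0 < gap s" if "s \<le> t" for s
    using point[OF that] m_pos \<epsilon> by (meson less_trans mult_pos_pos of_nat_0_less_iff)
  define \<Psi> where "\<Psi> d = 7 * (d - (real m)\<^sup>2 / d)" for d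
  have "\<Psi> (gap s) \<le> \<Psi> (gap 0) - real s" if "s \<le> t" for s
    using that
  proof (induction s)
    case (Suc s)
    then have s: "fw_point m n a (xs s)" "fw_gap a (xs s) (vs s) \<noteq> 0" using point by auto
    interpret fw_step m n a "xs s" "vs s" using s(1) by (rule fw_step_vs)
    have "gap (Suc s) \<le> gap s - G\<^sup>2 / (2 * ((G + real m) * (2 * G + real m)))"
      using barrier_decrease[OF s(2)] by (simp add: gap_def Let_def)
    then have "\<Psi> (gap (Suc s)) \<le> \<Psi> (gap s) - 1"
      unfolding \<Psi>_def using Suc.prems m_pos gap_pos gap_le_fw_gap[OF s(1)]
      by (intro potential_decrease) auto
    with Suc show ?case by simp
  qed simp
  from this[of t] have "real t \<le> \<Psi> (gap 0) - \<Psi> (gap t)" by simp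
  \<comment> \<open>Only nonpositive terms are dropped: the reciprocal part at 0 and the linear part
    at \<open>t\<close>.\<close>
  also have "\<dots> \<le> 7 * (gap 0 + (real m)\<^sup>2 / gap t)"
  proof -
    have "0 \<le> (real m)\<^sup>2 / gap 0" "0 \<le> gap t" using gap_pos[of 0] gap_pos[of t] by auto
    then show ?thesis by (simp add: \<Psi>_def right_diff_distrib distrib_left)
  qed
  also have "\<dots> \<le> 7 * (real m * ln (real n) + (real m)\<^sup>2 / (real m * \<epsilon>))"
    using gap_start point[of t] m_pos \<epsilon> gap_pos[of t]
    by (intro mult_left_mono add_mono divide_left_mono mult_pos_pos) auto
  also have "(real m)\<^sup>2 / (real m * \<epsilon>) = real m / \<epsilon>" by (simp add: power2_eq_square)
  finally show ?thesis using point by auto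
qed

lemma fw_lhb_complexity:
  assumes \<epsilon>: "0 < \<epsilon>"
  shows "\<exists>T. fw_lhb_iterate n a T (fst (fw_lhb lmo a n T)) \<and>
    eps_optimal n a \<epsilon> (fst (fw_lhb lmo a n T)) \<and>
    real (snd (fw_lhb lmo a n T)) \<le>
      1 + (7 * (real m * ln (real n) + real m / \<epsilon>) + 1) * (real (21 + \<kappa>) * real m * real n)"
proof -
  define B where "B = 7 * (real m * ln (real n) + real m / \<epsilon>)"
  have B: "0 \<le> B" using \<epsilon> n_pos by (simp add: B_def)
  obtain k where k: "B < real k" using reals_Archimedean2 by blast
  have "\<exists>s\<le>k. eps_optimal n a \<epsilon> (xs s)"
    using not_eps_optimal_bound[OF \<epsilon>, of k] k by (force simp: B_def)
  then obtain s0 where "eps_optimal n a \<epsilon> (xs s0)" by blast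
  \<comment> \<open>At the first success every earlier iterate misses the target, so the run reaches
    \<open>T\<close> without stopping and the iteration bound applies to the predecessor of
    \<open>T\<close>; this accounts for the extra 1.\<close>
  define T where "T = (LEAST s. eps_optimal n a \<epsilon> (xs s))"
  have T: "eps_optimal n a \<epsilon> (xs T)" unfolding T_def by (rule LeastI) fact
  have less_T: "\<not> eps_optimal n a \<epsilon> (xs s)" if "s < T" for s
    using that not_less_Least unfolding T_def by blast
  have gaps: "fw_gap a (xs s) (vs s) \<noteq> 0" if "s < T" for s
    using not_eps_optimal_bound[OF \<epsilon>, of s] less_T that by auto
  have "real T \<le> B + 1"
  proof (cases T)
    case (Suc t)
    then show ?thesis using not_eps_optimal_bound[OF \<epsilon>, of t] less_T by (auto simp: B_def)
  qed (use B in simp)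
  then have "real T * (real (21 + \<kappa>) * real m * real n)
      \<le> (B + 1) * (real (21 + \<kappa>) * real m * real n)"
    by (intro mult_right_mono) auto
  moreover have "real (snd (fw_lhb lmo a n T)) \<le> real (1 + T * ((21 + \<kappa>) * m * n))"
    using fw_lhb_conv(2)[OF gaps] by (intro of_nat_mono) auto
  moreover have "real (1 + T * ((21 + \<kappa>) * m * n))
      = 1 + real T * (real (21 + \<kappa>) * real m * real n)"
    by (simp only: of_nat_add of_nat_mult of_nat_1)
  ultimately have "real (snd (fw_lhb lmo a n T))
      \<le> 1 + (B + 1) * (real (21 + \<kappa>) * real m * real n)"
    by linarith
  then show ?thesis
    using T run_point[OF gaps] fw_lhb_conv(1)[OF gaps] by (intro exI[of _ T]) (simp add: B_def)
qed

end

section \<open>From the iteration count to the asymptotic form\<close>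

text \<open>The factor \<open>ln m + ln (ln N)\<close> is at least \<open>ln (ln 3) > 0\<close>, so
  inserting it costs only the constant \<open>1 / ln (ln 3)\<close>.\<close>

lemma complexity_bound:
  fixes m n A \<epsilon> :: real
  assumes "1 \<le> m" "1 \<le> n" "1 \<le> A" "0 < \<epsilon>"
  defines "N \<equiv> max n 3"
  shows "1 + (7 * (m * ln n + m / \<epsilon>) + 1) * (A * m * n)
    \<le> 9 * A * (1 + 1 / ln (ln 3)) * (m\<^sup>2 * n * ln N * (ln m + ln (ln N)) + m\<^sup>2 * n / \<epsilon>)"
proof -
  have ln3: "1 < ln (3::real)" using exp_le ln3_gt_1 by simp
  define L where "L = ln (ln (3::real))"
  have L: "0 < L" using ln3 by (simp add: L_def)
  have lnN: "ln 3 \<le> ln N" "ln n \<le> ln N" using assms by (auto simp: N_def)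
  then have "L \<le> ln (ln N)" using ln3 by (auto simp: L_def)
  then have LN: "L \<le> ln m + ln (ln N)" using assms by (simp add: add_increasing)
  define P where "P = m\<^sup>2 * n * ln N"
  define Q where "Q = m\<^sup>2 * n / \<epsilon>"
  have m2: "m \<le> m\<^sup>2" using assms by (simp add: power2_eq_square)
  have mn: "m * n \<le> P"
  proof -
    have "m * n * 1 \<le> m\<^sup>2 * n * ln N"
      using m2 assms(1-4) lnN ln3 by (intro mult_mono) auto
    then show ?thesis by (simp add: P_def)
  qed
  have mn1: "1 \<le> m * n" using mult_mono[of 1 m 1 n] assms by simp
  have PQ: "0 \<le> P" "0 \<le> Q" using mn mn1 assms by (auto simp: Q_def)
  have "m\<^sup>2 * n * ln n \<le> P" unfolding P_def using lnN assms by (intro mult_left_mono) auto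
  moreover have "(7 * (m * ln n + m / \<epsilon>) + 1) * (A * m * n)
      = A * (7 * (m\<^sup>2 * n * ln n) + 7 * Q + m * n)"
    by (simp add: Q_def algebra_simps power2_eq_square add_divide_distrib)
  moreover have "1 \<le> A * P"
    using mult_mono[of 1 A 1 P] mn mn1 assms by simp
  \<comment> \<open>The coefficient 9 of \<open>P\<close> collects 7 from \<open>ln n\<close>, 1
    from \<open>m * n \<le> P\<close> and 1 from the leading 1.\<close>
  ultimately have "1 + (7 * (m * ln n + m / \<epsilon>) + 1) * (A * m * n)
      \<le> A * P + A * (7 * P + 7 * Q + P)"
    using mn assms(3) by (simp only:) (intro add_mono mult_left_mono, auto)
  also have "\<dots> \<le> 9 * A * (P + Q)" using PQ assms by (simp add: algebra_simps)
  also have "\<dots> \<le> 9 * A * ((1 + 1 / L) * (P * (ln m + ln (ln N)) + Q))"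
  proof (intro mult_left_mono)
    have "P = 1 / L * (P * L)" using L by simp
    also have "\<dots> \<le> 1 / L * (P * (ln m + ln (ln N)))"
      using L LN PQ by (intro mult_left_mono) auto
    finally have "P \<le> 1 / L * (P * (ln m + ln (ln N)))" .
    moreover have "0 \<le> P * (ln m + ln (ln N))" "0 \<le> 1 / L * Q"
      using L LN PQ by auto
    ultimately show "P + Q \<le> (1 + 1 / L) * (P * (ln m + ln (ln N)) + Q)"
      by (simp add: distrib_left distrib_right)
  qed (use assms in auto)
  finally show ?thesis unfolding P_def Q_def L_def by (simp only: mult.assoc)
qed

text \<open>The constant depends on \<open>\<kappa>\<close> alone. Taking
  \<open>max (real n) 3\<close> gives the iterated logarithm a positive value also for
  \<open>n \<le> 2\<close>.\<close>

theorem proposition3: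
  fixes \<kappa> :: nat
  shows "\<exists>C::real. 0 < C \<and> (\<forall>(m::nat) (n::nat) (a :: real list list) (\<epsilon>::real) (lmo :: lmo).
    0 < m \<longrightarrow> 0 < n \<longrightarrow> log_instance m n a \<longrightarrow> 0 < \<epsilon> \<longrightarrow> exact_lmo \<kappa> n lmo \<longrightarrow>
    (\<exists>T x ops. fw_lhb lmo a n T = (x, ops) \<and> fw_lhb_iterate n a T x \<and> eps_optimal n a \<epsilon> x \<and>
      real ops \<le> C * (let N = max (real n) 3 in
        real m ^ 2 * real n * ln N * (ln (real m) + ln (ln N)) + real m ^ 2 * real n / \<epsilon>)))"
proof (rule exI[of _ "9 * real (21 + \<kappa>) * (1 + 1 / ln (ln 3))"], intro conjI allI impI)
  have "1 < ln (3::real)" by (rule ln3_gt_1)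
  then show "0 < 9 * real (21 + \<kappa>) * (1 + 1 / ln (ln 3))"
    by (intro mult_pos_pos add_pos_pos) auto
next
  fix m n :: nat and a :: "real list list" and \<epsilon> :: real and lmo :: lmo
  assume *: "0 < m" "0 < n" "log_instance m n a" "0 < \<epsilon>" "exact_lmo \<kappa> n lmo"
  then interpret fw_run m n \<kappa> a lmo by unfold_locales
  obtain T where T: "fw_lhb_iterate n a T (fst (fw_lhb lmo a n T))"
    "eps_optimal n a \<epsilon> (fst (fw_lhb lmo a n T))"
    "real (snd (fw_lhb lmo a n T)) \<le>
      1 + (7 * (real m * ln (real n) + real m / \<epsilon>) + 1) * (real (21 + \<kappa>) * real m * real n)"
    using fw_lhb_complexity[OF *(4)] by blast
  note T(3)
  also have "\<dots> \<le> 9 * real (21 + \<kappa>) * (1 + 1 / ln (ln 3)) * (let N = max (real n) 3 in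
      real m ^ 2 * real n * ln N * (ln (real m) + ln (ln N)) + real m ^ 2 * real n / \<epsilon>)"
    unfolding Let_def using * by (intro complexity_bound) simp_all
  finally show "\<exists>T x ops. fw_lhb lmo a n T = (x, ops) \<and> fw_lhb_iterate n a T x \<and>
      eps_optimal n a \<epsilon> x \<and>
      real ops \<le> 9 * real (21 + \<kappa>) * (1 + 1 / ln (ln 3)) * (let N = max (real n) 3 in
        real m ^ 2 * real n * ln N * (ln (real m) + ln (ln N)) + real m ^ 2 * real n / \<epsilon>)"
    using T(1,2) by (intro exI conjI) (rule prod.collapse[symmetric])
qed

end
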